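(* Let $\hbar,m>0$ be constants and put $\alpha=-\dfrac{\hbar}{2m}$, $\beta=\dfrac1\hbar$. Let $n\in\{0,1,2,\dots\}$, let $T\subseteq\mathbb{R}$ be an open time interval, let $\sigma:T\to(0,\infty)$ be sufficiently smooth (at least $C^2$), and let $E_n:T\to\mathbb{R}$ be a function with $$\dot E_n(t)=-\frac{\alpha}{\beta\,\sigma^2(t)}\left(n+\frac12\right),\qquad t\in T.$$ Then the wave function $$\Psi_n^1(x,t)=\frac{1}{\sqrt{2^n n!}}\,\frac{1}{\sqrt{\sqrt{2\pi}\,\sigma(t)}}\exp\left(-\frac{x^2}{4\sigma^2(t)}-i\frac{\dot\sigma(t)}{4\alpha\,\sigma(t)}x^2-i\beta E_n(t)\right)H_n\left(\frac{x}{\sqrt2\,\sigma(t)}\right)$$ is a solution, for $x\in\mathbb{R}$ and $t\in T$, of the Schrödinger equation $$i\hbar\frac{\partial\Psi_n^1}{\partial t}=-\frac{\hbar^2}{2m}\frac{\partial^2\Psi_n^1}{\partial x^2}+U^1\Psi_n^1$$ with the potential $$U^1(x,t)=\frac{1}{4\alpha\beta\,\sigma(t)}\left[\ddot\sigma(t)-\frac{\alpha^2}{\sigma^3(t)}\right]x^2.$$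
   Context: $H_n$ denotes the physicists' Hermite polynomial of degree $n$ (so $H_0=1$, $H_1(y)=2y$, $H_n'=2nH_{n-1}$). Dots denote derivatives with respect to time $t$. *)

theory Defs
  imports "HOL-Analysis.Analysis" "HOL-Computational_Algebra.Polynomial"
begin

text \<open>Physicists' Hermite polynomials, by the three-term recurrence.\<close>

fun hermite :: "nat \<Rightarrow> real poly" where
  "hermite 0 = 1"
| "hermite (Suc 0) = [:0, 2:]"
| "hermite (Suc (Suc n)) = [:0, 2:] * hermite (Suc n) - smult (2 * real (Suc n)) (hermite n)"

lemma pderiv_hermite_Suc: "pderiv (hermite (Suc n)) = smult (2 * real (Suc n)) (hermite n)"
proof (induction n rule: hermite.induct)
  case (3 n)
  have "poly (pderiv (hermite (Suc (Suc (Suc n))))) x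
      = poly (smult (2 * real (Suc (Suc (Suc n)))) (hermite (Suc (Suc n)))) x" for x
    unfolding hermite.simps(3)[of "Suc n"] pderiv_diff pderiv_mult pderiv_smult 3
    by (simp add: pderiv_pCons algebra_simps)
  then show ?case
    by (simp add: poly_eq_poly_eq_iff[symmetric] fun_eq_iff)
qed (auto simp: pderiv_pCons pderiv_mult pderiv_diff pderiv_smult one_pCons)

lemma pderiv_hermite: "pderiv (hermite n) = smult (2 * real n) (hermite (n - 1))"
  by (cases n) (simp_all add: pderiv_hermite_Suc del: hermite.simps(3))

lemma hermite_Rodrigues:
  "poly (hermite n) y = (-1) ^ n * exp (y\<^sup>2) * (deriv ^^ n) (\<lambda>u. exp (- u\<^sup>2)) y"
proof -
  have step: "hermite (Suc n) = [:0, 2:] * hermite n - pderiv (hermite n)" for n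
    by (cases n) (simp_all add: pderiv_hermite_Suc)
  have "(deriv ^^ n) (\<lambda>u::real. exp (- u\<^sup>2)) = (\<lambda>u. (-1) ^ n * exp (- u\<^sup>2) * poly (hermite n) u)"
  proof (induction n)
    case (Suc n)
    have "((\<lambda>u. (-1) ^ n * exp (- u\<^sup>2) * poly (hermite n) u) has_real_derivative
        (-1) ^ Suc n * exp (- u\<^sup>2) * poly (hermite (Suc n)) u) (at u)" for u :: real
      unfolding step
      by (auto intro!: derivative_eq_intros poly_DERIV simp: algebra_simps)
    then have "deriv (\<lambda>u. (-1) ^ n * exp (- u\<^sup>2) * poly (hermite n) u) u
        = (-1) ^ Suc n * exp (- u\<^sup>2) * poly (hermite (Suc n)) u" for u :: real
      by (rule DERIV_imp_deriv)
    then show ?case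
      by (simp only: funpow.simps comp_apply Suc)
  qed simp
  then show ?thesis
    by (cases "even n") (simp_all add: exp_minus)
qed

text \<open>Meant for open \<open>T\<close>: the derivatives are two-sided.\<close>

definition C2_on :: "real set \<Rightarrow> (real \<Rightarrow> real) \<Rightarrow> bool" where
  "C2_on T f \<longleftrightarrow> f C1_differentiable_on T \<and> deriv f C1_differentiable_on T"

definition Psi1 ::
  "real \<Rightarrow> real \<Rightarrow> (real \<Rightarrow> real) \<Rightarrow> (real \<Rightarrow> real) \<Rightarrow> nat \<Rightarrow> real \<Rightarrow> real \<Rightarrow> complex" where
  "Psi1 \<alpha> \<beta> \<sigma> E n x t =
     of_real (1 / sqrt (2 ^ n * fact n)) * of_real (1 / sqrt (sqrt (2 * pi) * \<sigma> t)) *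
     exp (- of_real (x\<^sup>2 / (4 * (\<sigma> t)\<^sup>2))
          - \<i> * of_real (deriv \<sigma> t / (4 * \<alpha> * \<sigma> t) * x\<^sup>2)
          - \<i> * of_real (\<beta> * E t)) *
     of_real (poly (hermite n) (x / (sqrt 2 * \<sigma> t)))"

definition U1 :: "real \<Rightarrow> real \<Rightarrow> (real \<Rightarrow> real) \<Rightarrow> real \<Rightarrow> real \<Rightarrow> real" where
  "U1 \<alpha> \<beta> \<sigma> x t =
     1 / (4 * \<alpha> * \<beta> * \<sigma> t) * (deriv (deriv \<sigma>) t - \<alpha>\<^sup>2 / (\<sigma> t) ^ 3) * x\<^sup>2"

text \<open>Classical solutions. The library's \<^const>\<open>vector_derivative\<close> is total, so the existence of
  the partial derivatives occurring in the equation is demanded explicitly.\<close>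

definition schroedinger_solution ::
  "real \<Rightarrow> real \<Rightarrow> real set \<Rightarrow> (real \<Rightarrow> real \<Rightarrow> real) \<Rightarrow> (real \<Rightarrow> real \<Rightarrow> complex) \<Rightarrow> bool" where
  "schroedinger_solution hbar m T U \<Psi> \<longleftrightarrow>
     (\<forall>x. \<forall>t\<in>T.
        (\<lambda>s. \<Psi> x s) differentiable (at t) \<and>
        (\<lambda>y. \<Psi> y t) differentiable (at x) \<and>
        (\<lambda>y. vector_derivative (\<lambda>z. \<Psi> z t) (at y)) differentiable (at x) \<and>
        \<i> * of_real hbar * vector_derivative (\<lambda>s. \<Psi> x s) (at t) =
          - of_real (hbar\<^sup>2 / (2 * m)) *
            vector_derivative (\<lambda>y. vector_derivative (\<lambda>z. \<Psi> z t) (at y)) (at x)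
          + of_real (U x t) * \<Psi> x t)"

end

theory Submission
  imports Defs
begin

text \<open>Writing the wave function as a gaussian times \<open>H\<^sub>n(x / (\<surd>2 \<sigma>))\<close>, both sides of the
  equation become the gaussian times a combination of \<open>H\<^sub>n\<close> and \<open>H\<^sub>n'\<close>, because
  Hermite's equation \<open>H\<^sub>n'' = 2 y H\<^sub>n' - 2 n H\<^sub>n\<close> eliminates the second derivative. The
  coefficients of \<open>H\<^sub>n'\<close> agree; for \<open>H\<^sub>n\<close>, the constant terms agree by the choice of \<open>E\<^sub>n\<close> and
  the \<open>x\<^sup>2\<close> terms by the choice of the potential.\<close>

text \<open>In the three-term recurrence, the subtracted multiple of the polynomial two degrees
  lower is exactly the derivative of the one before.\<close>

lemma hermite_Suc: "hermite (Suc n) = [:0, 2:] * hermite n - pderiv (hermite n)"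
  by (cases n) (simp_all add: pderiv_hermite_Suc)

text \<open>Differentiate H_{n+1} = 2 y H_n - H_n' and use H_{n+1}' = 2 (n+1) H_n; this leaves 2
  (n+1) H_n = 2 H_n + 2 y H_n' - H_n''.\<close>

lemma hermite_equation:
  "poly (pderiv (pderiv (hermite n))) y =
     2 * y * poly (pderiv (hermite n)) y - 2 * real n * poly (hermite n) y"
proof -
  have "smult (2 * real (Suc n)) (hermite n) =
      pderiv ([:0, 2:] * hermite n - pderiv (hermite n))"
    by (simp only: pderiv_hermite_Suc [symmetric] hermite_Suc)
  then have "poly (smult (2 * real (Suc n)) (hermite n)) y =
      poly (pderiv ([:0, 2:] * hermite n - pderiv (hermite n))) y"
    by (rule arg_cong)
  then show ?thesis
    by (simp add: pderiv_diff pderiv_mult pderiv_pCons pderiv_smult algebra_simps)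
qed

lemma has_vector_derivative_exp:
  fixes f :: "real \<Rightarrow> complex"
  assumes "(f has_vector_derivative f') (at t)"
  shows "((\<lambda>s. exp (f s)) has_vector_derivative f' * exp (f t)) (at t)"
  using field_vector_diff_chain_at [OF assms DERIV_exp] by (simp add: o_def)

text \<open>The result is again the same gaussian times a function, and \<open>q\<close> is
  arbitrary, so the rule can be iterated to reach the second derivative in x.\<close>

lemma has_vector_derivative_gaussian_mult:
  fixes q :: "real \<Rightarrow> complex"
  assumes "(q has_vector_derivative q') (at x)"
  shows "((\<lambda>y. C * exp (A * of_real (y\<^sup>2) + B) * q y) has_vector_derivative
    C * exp (A * of_real (x\<^sup>2) + B) * (2 * A * of_real x * q x + q')) (at x)"
proof -
  have "((\<lambda>y. y\<^sup>2) has_real_derivative 2 * x) (at x)"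
    by (auto intro!: derivative_eq_intros)
  then have "((\<lambda>y. A * of_real (y\<^sup>2) + B) has_vector_derivative A * of_real (2 * x)) (at x)"
    unfolding has_vector_derivative_add_const
    by (intro has_vector_derivative_mult_right has_vector_derivative_of_real)
  from has_vector_derivative_exp [OF this]
  have "((\<lambda>y. C * exp (A * of_real (y\<^sup>2) + B)) has_vector_derivative
      C * (A * of_real (2 * x) * exp (A * of_real (x\<^sup>2) + B))) (at x)"
    by (rule has_vector_derivative_mult_right)
  from has_vector_derivative_mult [OF this assms] show ?thesis
    by (simp add: algebra_simps)
qed

text \<open>Two applications of the gaussian product rule: first to q(y) = p(k y), then to the
  bracket 2 A y p(k y) + k p'(k y) which it produces.\<close>

lemma vector_derivative_gaussian_poly:
  fixes A B C :: complex and p :: "real poly" and k :: real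
  defines "f \<equiv> \<lambda>y. C * exp (A * of_real (y\<^sup>2) + B) * of_real (poly p (k * y))"
  defines "f' \<equiv> \<lambda>y. C * exp (A * of_real (y\<^sup>2) + B) *
    (2 * A * of_real y * of_real (poly p (k * y)) + of_real (k * poly (pderiv p) (k * y)))"
  shows "(f has_vector_derivative f' x) (at x)"
    and "(f' has_vector_derivative C * exp (A * of_real (x\<^sup>2) + B) *
      ((2 * A + 4 * A\<^sup>2 * of_real (x\<^sup>2)) * of_real (poly p (k * x)) +
       4 * A * of_real (x * k * poly (pderiv p) (k * x)) +
       of_real (k\<^sup>2 * poly (pderiv (pderiv p)) (k * x)))) (at x)"
proof -
  have poly: "((\<lambda>y. complex_of_real (poly r (k * y))) has_vector_derivative
      of_real (k * poly (pderiv r) (k * y))) (at y)" for r y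
    by (rule has_vector_derivative_of_real)
      (auto intro!: derivative_eq_intros)
  show "(f has_vector_derivative f' x) (at x)"
    unfolding f_def f'_def by (rule has_vector_derivative_gaussian_mult [OF poly])
  have kpoly: "((\<lambda>y. complex_of_real (k * poly (pderiv p) (k * y))) has_vector_derivative
      of_real (k * (k * poly (pderiv (pderiv p)) (k * x)))) (at x)"
    using has_vector_derivative_mult_right [OF poly, of "of_real k" "pderiv p" x] by simp
  have lin: "((\<lambda>y. 2 * A * complex_of_real y) has_vector_derivative 2 * A) (at x)"
    using has_vector_derivative_mult_right [OF has_vector_derivative_of_real
        [OF DERIV_ident], of "2 * A"] by simp
  show "(f' has_vector_derivative C * exp (A * of_real (x\<^sup>2) + B) *
      ((2 * A + 4 * A\<^sup>2 * of_real (x\<^sup>2)) * of_real (poly p (k * x)) +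
       4 * A * of_real (x * k * poly (pderiv p) (k * x)) +
       of_real (k\<^sup>2 * poly (pderiv (pderiv p)) (k * x)))) (at x)"
    unfolding f'_def
    by (rule has_vector_derivative_eq_rhs [OF has_vector_derivative_gaussian_mult
          [OF has_vector_derivative_add [OF has_vector_derivative_mult [OF lin poly] kpoly]]])
      (simp add: algebra_simps power2_eq_square)
qed

lemma has_vector_derivative_modulated:
  fixes g h :: "real \<Rightarrow> real" and \<phi> :: "real \<Rightarrow> complex"
  assumes "(g has_real_derivative g') (at t)"
    and "(\<phi> has_vector_derivative \<phi>') (at t)"
    and "(h has_real_derivative h') (at t)"
  shows "((\<lambda>s. c * of_real (g s) * exp (\<phi> s) * of_real (h s)) has_vector_derivative
    c * exp (\<phi> t) * ((of_real g' + of_real (g t) * \<phi>') * of_real (h t)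
      + of_real (g t) * of_real h')) (at t)"
proof -
  note assms(1,3) [THEN has_vector_derivative_of_real]
  note has_vector_derivative_mult [OF has_vector_derivative_mult
      [OF has_vector_derivative_mult_right [OF this(1), of c]
        has_vector_derivative_exp [OF assms(2)]] this(2)]
  then show ?thesis
    by (rule has_vector_derivative_eq_rhs) (simp add: algebra_simps)
qed

text \<open>Merging both x^2 terms of the exponent into one complex coefficient gives, at fixed
  time, the shape C exp(A x^2 + B) p(k x).\<close>

lemma Psi1_gaussian_form:
  "Psi1 \<alpha> \<beta> \<sigma> E n x t =
     of_real (1 / sqrt (2 ^ n * fact n)) * of_real (1 / sqrt (sqrt (2 * pi) * \<sigma> t)) *
     exp (Complex (- 1 / (4 * (\<sigma> t)\<^sup>2)) (- deriv \<sigma> t / (4 * \<alpha> * \<sigma> t)) * of_real (x\<^sup>2)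
       + (- \<i> * of_real (\<beta> * E t))) *
     of_real (poly (hermite n) (1 / (sqrt 2 * \<sigma> t) * x))"
  unfolding Psi1_def
  by (intro arg_cong2 [where f = "(*)"] arg_cong [where f = exp] refl)
    (auto simp: complex_eq_iff)

text \<open>The bracket collects three contributions: the logarithmic derivative of the amplitude,
  the derivative of the exponent, where \<open>A'\<close> is the time derivative of the coefficient
  of x^2, and the chain rule for the argument k x, whose time derivative is -(\<sigma>'/\<sigma>) k
  x.\<close>

lemma has_vector_derivative_Psi1_time:
  fixes \<alpha> :: real
  assumes "\<sigma> t > 0" and "\<alpha> \<noteq> 0"
    and \<sigma>': "(\<sigma> has_real_derivative deriv \<sigma> t) (at t)"
    and \<sigma>'': "(deriv \<sigma> has_real_derivative \<sigma>2) (at t)"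
    and E': "(E has_real_derivative E') (at t)"
  defines "A' \<equiv> Complex (deriv \<sigma> t / (2 * \<sigma> t ^ 3))
      ((deriv \<sigma> t)\<^sup>2 / (4 * \<alpha> * (\<sigma> t)\<^sup>2) - \<sigma>2 / (4 * \<alpha> * \<sigma> t))"
    and "k \<equiv> 1 / (sqrt 2 * \<sigma> t)"
  shows "((\<lambda>s. Psi1 \<alpha> \<beta> \<sigma> E n x s) has_vector_derivative
    of_real (1 / sqrt (2 ^ n * fact n)) * of_real (1 / sqrt (sqrt (2 * pi) * \<sigma> t)) *
     exp (Complex (- 1 / (4 * (\<sigma> t)\<^sup>2)) (- deriv \<sigma> t / (4 * \<alpha> * \<sigma> t)) * of_real (x\<^sup>2)
       + (- \<i> * of_real (\<beta> * E t))) *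
    ((- of_real (deriv \<sigma> t / (2 * \<sigma> t)) + A' * of_real (x\<^sup>2) - \<i> * of_real (\<beta> * E')) *
        of_real (poly (hermite n) (k * x))
      - of_real (deriv \<sigma> t / \<sigma> t * (k * x) * poly (pderiv (hermite n)) (k * x)))) (at t)"
proof -
  define g where "g = (\<lambda>s. 1 / sqrt (sqrt (2 * pi) * \<sigma> s))"
  \<comment> \<open>The amplitude is proportional to \<sigma>^(-1/2). Its derivative is written as a
    multiple of \<open>g t\<close> so that the amplitude factors out of the whole
    derivative.\<close>
  have g: "(g has_real_derivative - (deriv \<sigma> t / (2 * \<sigma> t)) * g t) (at t)"
  proof -
    \<comment> \<open>Only the sign of the constant \<open>sqrt (2 * pi)\<close> matters here, so an
      arbitrary positive \<open>K\<close> stands for it.\<close>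
    have "((\<lambda>s. 1 / sqrt (K * \<sigma> s)) has_real_derivative
        - (deriv \<sigma> t / (2 * \<sigma> t)) * (1 / sqrt (K * \<sigma> t))) (at t)" if "K > 0" for K
      using that assms(1)
      by (auto intro!: derivative_eq_intros \<sigma>' simp: divide_simps mult_less_0_iff)
    then show ?thesis
      unfolding g_def by simp
  qed
  have re: "((\<lambda>s. - 1 / (4 * (\<sigma> s)\<^sup>2)) has_real_derivative Re A') (at t)"
    using assms(1) unfolding A'_def
    by (auto intro!: derivative_eq_intros \<sigma>' simp: field_simps eval_nat_numeral)
  have im: "((\<lambda>s. - deriv \<sigma> s / (4 * \<alpha> * \<sigma> s)) has_real_derivative Im A') (at t)"
    using assms(1,2) unfolding A'_def
    by (auto intro!: derivative_eq_intros \<sigma>' \<sigma>'' simp: field_simps eval_nat_numeral)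
  \<comment> \<open>Taken componentwise: \<open>re\<close> and \<open>im\<close> give the x^2 terms,
    and the energy phase enters only the imaginary part.\<close>
  have \<phi>: "((\<lambda>s. Complex (- 1 / (4 * (\<sigma> s)\<^sup>2)) (- deriv \<sigma> s / (4 * \<alpha> * \<sigma> s)) * of_real (x\<^sup>2)
      + (- \<i> * of_real (\<beta> * E s))) has_vector_derivative
      A' * of_real (x\<^sup>2) + (- \<i> * of_real (\<beta> * E'))) (at t)"
    using DERIV_cmult_right [OF re, of "x\<^sup>2"]
      DERIV_diff [OF DERIV_cmult_right [OF im, of "x\<^sup>2"] DERIV_cmult [OF E', of \<beta>]]
    unfolding has_vector_derivative_complex_iff by simp
  have h: "((\<lambda>s. poly (hermite n) (1 / (sqrt 2 * \<sigma> s) * x)) has_real_derivative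
      - (deriv \<sigma> t / \<sigma> t * (k * x) * poly (pderiv (hermite n)) (k * x))) (at t)"
    using assms(1) unfolding k_def
    by (auto intro!: derivative_eq_intros \<sigma>' simp: field_simps eval_nat_numeral)
  have amplitude: "1 / sqrt (sqrt (2 * pi) * \<sigma> s) = g s" for s
    by (simp add: g_def)
  show ?thesis
    unfolding Psi1_gaussian_form amplitude
    by (rule has_vector_derivative_eq_rhs
        [OF has_vector_derivative_modulated [OF g \<phi> h]])
      (simp add: k_def algebra_simps)
qed

text \<open>The equation divided by the gaussian factor; \<open>h\<close>, \<open>h1\<close> stand for \<open>H\<^sub>n\<close>, \<open>H\<^sub>n'\<close> and
  \<open>s\<close>, \<open>s1\<close>, \<open>s2\<close> for \<open>\<sigma>\<close> and its derivatives. The factors are those of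
  \<open>has_vector_derivative_Psi1_time\<close> and \<open>vector_derivative_gaussian_poly\<close>.\<close>

lemma reduced_schroedinger:
  fixes \<alpha> \<beta> s s1 s2 x k h h1 h2 :: real
  assumes "\<alpha> \<noteq> 0" "\<beta> \<noteq> 0" "s \<noteq> 0"
    and k: "k\<^sup>2 = 1 / (2 * s\<^sup>2)"
    and h2: "h2 = 2 * (k * x) * h1 - 2 * real n * h"
  defines "A \<equiv> Complex (- 1 / (4 * s\<^sup>2)) (- s1 / (4 * \<alpha> * s))"
    and "A' \<equiv> Complex (s1 / (2 * s ^ 3)) (s1\<^sup>2 / (4 * \<alpha> * s\<^sup>2) - s2 / (4 * \<alpha> * s))"
    and "E' \<equiv> - \<alpha> / (\<beta> * s\<^sup>2) * (real n + 1 / 2)"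
    and "u \<equiv> 1 / (4 * \<alpha> * \<beta> * s) * (s2 - \<alpha>\<^sup>2 / s ^ 3) * x\<^sup>2"
  shows "\<i> * of_real (1 / \<beta>) *
      ((- of_real (s1 / (2 * s)) + A' * of_real (x\<^sup>2) - \<i> * of_real (\<beta> * E')) * of_real h
        - of_real (s1 / s * (k * x) * h1)) =
    of_real (\<alpha> / \<beta>) * ((2 * A + 4 * A\<^sup>2 * of_real (x\<^sup>2)) * of_real h
        + 4 * A * of_real (x * k * h1) + of_real (k\<^sup>2 * h2)) + of_real u * of_real h"
  \<comment> \<open>Once \<open>k\<^sup>2\<close> and \<open>h2\<close> are replaced,
    \<open>k\<close> survives only to first power in the terms with \<open>h1\<close>. No root is
    left, and the real and imaginary parts are rational identities. In the real part the
    \<open>h1\<close> terms cancel.\<close>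
  using assms(1-3)
  unfolding k h2 A_def A'_def E'_def u_def
  by (auto simp: complex_eq_iff power2_eq_square divide_simps) (auto simp: algebra_simps eval_nat_numeral)

theorem theorem2:
  fixes hbar m \<alpha> \<beta> :: real and n :: nat and T :: "real set"
    and \<sigma> E :: "real \<Rightarrow> real"
  assumes "hbar > 0" and "m > 0"
    and "\<alpha> = - hbar / (2 * m)" and "\<beta> = 1 / hbar"
    and "open T" and "is_interval T"
    and "\<And>t. t \<in> T \<Longrightarrow> \<sigma> t > 0"
    and "C2_on T \<sigma>"
    and "\<And>t. t \<in> T \<Longrightarrow>
      (E has_real_derivative - \<alpha> / (\<beta> * (\<sigma> t)\<^sup>2) * (real n + 1 / 2)) (at t)"
  shows "schroedinger_solution hbar m T (U1 \<alpha> \<beta> \<sigma>) (Psi1 \<alpha> \<beta> \<sigma> E n)"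
  unfolding schroedinger_solution_def
proof (intro allI ballI)
  fix x t assume t: "t \<in> T"
  define c where "c = complex_of_real (1 / sqrt (2 ^ n * fact n)) *
    of_real (1 / sqrt (sqrt (2 * pi) * \<sigma> t))"
  define A where "A = Complex (- 1 / (4 * (\<sigma> t)\<^sup>2)) (- deriv \<sigma> t / (4 * \<alpha> * \<sigma> t))"
  define B where "B = - \<i> * complex_of_real (\<beta> * E t)"
  define k where "k = 1 / (sqrt 2 * \<sigma> t)"
  have pos: "\<sigma> t > 0" using assms t by simp
  have nz: "\<alpha> \<noteq> 0" "\<beta> \<noteq> 0" using assms by auto
  \<comment> \<open>\<open>C1_differentiable_on\<close> supplies some derivative; uniqueness
    identifies it with \<open>deriv\<close>.\<close>
  have \<sigma>': "(\<sigma> has_real_derivative deriv \<sigma> t) (at t)"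
    and \<sigma>'': "(deriv \<sigma> has_real_derivative deriv (deriv \<sigma>) t) (at t)"
    using assms(8) t unfolding C2_on_def C1_differentiable_on_def
    by (metis DERIV_imp_deriv has_real_derivative_iff_has_vector_derivative)+
  have form: "Psi1 \<alpha> \<beta> \<sigma> E n y t =
      c * exp (A * of_real (y\<^sup>2) + B) * of_real (poly (hermite n) (k * y))" for y
    unfolding Psi1_gaussian_form c_def A_def B_def k_def ..
  note dt = has_vector_derivative_Psi1_time [where \<sigma> = \<sigma> and t = t and \<beta> = \<beta> and n = n and x = x,
      OF pos nz(1) \<sigma>' \<sigma>'' assms(9) [OF t],
      folded c_def A_def B_def k_def]
  note dx = vector_derivative_gaussian_poly [of c A B "hermite n" k, folded form]
  \<comment> \<open>\<open>dx(1)\<close> holds at every point, so this equation can rewrite the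
    inner derivative under the binder of the outer one.\<close>
  note dx_eq = vector_derivative_at [OF dx(1)]
  have k: "k\<^sup>2 = 1 / (2 * (\<sigma> t)\<^sup>2)"
    by (simp add: k_def power_divide power_mult_distrib)
  have hbar_eqs: "hbar = 1 / \<beta>" "hbar\<^sup>2 / (2 * m) = - (\<alpha> / \<beta>)"
    using assms by (simp_all add: power2_eq_square)
  note red = reduced_schroedinger [where x = x and n = n and ?s1.0 = "deriv \<sigma> t" and ?s2.0 = "deriv (deriv \<sigma>) t",
      OF nz less_imp_neq [OF pos, symmetric] k hermite_equation, folded A_def U1_def]
  show "(\<lambda>s. Psi1 \<alpha> \<beta> \<sigma> E n x s) differentiable (at t) \<and>
    (\<lambda>y. Psi1 \<alpha> \<beta> \<sigma> E n y t) differentiable (at x) \<and>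
    (\<lambda>y. vector_derivative (\<lambda>z. Psi1 \<alpha> \<beta> \<sigma> E n z t) (at y)) differentiable (at x) \<and>
    \<i> * of_real hbar * vector_derivative (\<lambda>s. Psi1 \<alpha> \<beta> \<sigma> E n x s) (at t) =
      - of_real (hbar\<^sup>2 / (2 * m)) *
        vector_derivative (\<lambda>y. vector_derivative (\<lambda>z. Psi1 \<alpha> \<beta> \<sigma> E n z t) (at y)) (at x)
      + of_real (U1 \<alpha> \<beta> \<sigma> x t) * Psi1 \<alpha> \<beta> \<sigma> E n x t"
  proof (intro conjI)
    show "(\<lambda>s. Psi1 \<alpha> \<beta> \<sigma> E n x s) differentiable (at t)"
      using dt by (rule differentiableI_vector)
    show "(\<lambda>y. Psi1 \<alpha> \<beta> \<sigma> E n y t) differentiable (at x)"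
      using dx(1) by (rule differentiableI_vector)
    show "(\<lambda>y. vector_derivative (\<lambda>z. Psi1 \<alpha> \<beta> \<sigma> E n z t) (at y)) differentiable (at x)"
      unfolding dx_eq using dx(2) by (rule differentiableI_vector)
    show "\<i> * of_real hbar * vector_derivative (\<lambda>s. Psi1 \<alpha> \<beta> \<sigma> E n x s) (at t) =
        - of_real (hbar\<^sup>2 / (2 * m)) *
          vector_derivative (\<lambda>y. vector_derivative (\<lambda>z. Psi1 \<alpha> \<beta> \<sigma> E n z t) (at y)) (at x)
        + of_real (U1 \<alpha> \<beta> \<sigma> x t) * Psi1 \<alpha> \<beta> \<sigma> E n x t"
      \<comment> \<open>Multiplying the reduced identity by the gaussian factor restores the full
        equation. The quotient with \<open>hbar\<^sup>2\<close> is rewritten before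
        \<open>hbar\<close> itself, and \<open>form\<close> comes last, when the derivatives of
        \<open>Psi1\<close> have been evaluated.\<close>
      using arg_cong [OF red, of "(*) (c * exp (A * of_real (x\<^sup>2) + B))"]
      unfolding dx_eq vector_derivative_at [OF dt] vector_derivative_at [OF dx(2)] hbar_eqs(2)
      unfolding hbar_eqs(1) form
      by (simp only: of_real_minus minus_minus distrib_left mult_ac)
  qed
qed

end
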